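(* $\mathrm{NID}\notin\Sigma_3$.
   Context: Fix a universal prefix-free machine $U$. $K$ denotes prefix-free Kolmogorov complexity and $K(x\mid y)$ conditional prefix-free complexity. For binary strings $x,y$ let $E(x,y)=\max\{K(x\mid y),K(y\mid x)\}$ and $\mathrm{NID}(x,y)=\dfrac{E(x,y)}{\max\{K(x),K(y)\}}$. The oscillation classes: an approximation of $F$ is a computable $f$ with $\lim_{s\to\infty}f(z,s)=F(z)$ for all $z$; $F\in\Sigma_1$ if it has an approximation nondecreasing in $s$; $F\in\Pi_1$ if it has one nonincreasing in $s$; $F\in\Sigma_{n+1}$ if it has a computable approximation $f$ such that for every $z$ there is $s_z$ with $f(z,t)$ nondecreasing for $t<s_z$ and $(f(z,t))_{t\geq s_z}$ a $\Pi_n$-approximation; $F\in\Pi_{n+1}$ likewise with nonincreasing for $t<s_z$ and $(f(z,t))_{t\geq s_z}$ a $\Sigma_n$-approximation. So $\Sigma_3$ means an approximation with phases up, down, up on each input. *)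

theory Defs
  imports Complex_Main "HOL-Library.Nat_Bijection" "HOL-Library.Sublist"
begin

datatype recf = Z | S | Id nat | Cn recf "recf list" | Pr recf recf | Mn recf

inductive eval :: "recf \<Rightarrow> nat list \<Rightarrow> nat \<Rightarrow> bool" where
  eval_Z: "eval Z xs 0"
| eval_S: "eval S (x # xs) (Suc x)"
| eval_Id: "i < length xs \<Longrightarrow> eval (Id i) xs (xs ! i)"
| eval_Cn: "list_all2 (\<lambda>g y. eval g xs y) gs ys \<Longrightarrow> eval f ys z \<Longrightarrow> eval (Cn f gs) xs z"
| eval_Pr0: "eval f xs y \<Longrightarrow> eval (Pr f g) (0 # xs) y"
| eval_PrS: "eval (Pr f g) (n # xs) y \<Longrightarrow> eval g (y # n # xs) z \<Longrightarrow> eval (Pr f g) (Suc n # xs) z"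
| eval_Mn: "eval f (n # xs) 0 \<Longrightarrow> (\<forall>m<n. \<exists>v>0. eval f (m # xs) v) \<Longrightarrow> eval (Mn f) xs n"

definition partial_computable :: "(nat \<Rightarrow> nat option) \<Rightarrow> bool" where
  "partial_computable \<phi> \<longleftrightarrow> (\<exists>r. \<forall>n v. eval r [n] v \<longleftrightarrow> \<phi> n = Some v)"

text \<open>Bijective binary encoding of binary strings as naturals.\<close>
fun str_enc :: "bool list \<Rightarrow> nat" where
  "str_enc [] = 0"
| "str_enc (b # xs) = 2 * str_enc xs + (if b then 2 else 1)"

definition rat_enc :: "rat \<Rightarrow> nat" where
  "rat_enc q = (case quotient_of q of (a, b) \<Rightarrow> prod_encode (int_encode a, nat b))"

definition pair_enc :: "bool list \<Rightarrow> bool list \<Rightarrow> nat" where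
  "pair_enc x y = prod_encode (str_enc x, str_enc y)"

text \<open>A conditional machine maps (program, condition) to an optional output.\<close>
type_synonym machine = "bool list \<Rightarrow> bool list \<Rightarrow> bool list option"

definition prefix_free_machine :: "machine \<Rightarrow> bool" where
  "prefix_free_machine M \<longleftrightarrow>
     (\<forall>y p q. M p y \<noteq> None \<and> M q y \<noteq> None \<and> prefix p q \<longrightarrow> p = q)"

definition computable_machine :: "machine \<Rightarrow> bool" where
  "computable_machine M \<longleftrightarrow>
     (\<exists>r. \<forall>p y v. eval r [pair_enc p y] v \<longleftrightarrow> (\<exists>x. M p y = Some x \<and> v = str_enc x))"

definition universal_pf_machine :: "machine \<Rightarrow> bool" where
  "universal_pf_machine U \<longleftrightarrow>
     prefix_free_machine U \<and> computable_machine U \<and>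
     (\<forall>M. prefix_free_machine M \<and> computable_machine M \<longrightarrow>
        (\<exists>c. \<forall>p y x. M p y = Some x \<longrightarrow> (\<exists>q. U q y = Some x \<and> length q \<le> length p + c)))"

definition Kc :: "machine \<Rightarrow> bool list \<Rightarrow> bool list \<Rightarrow> nat" where
  "Kc U x y = (LEAST n. \<exists>p. U p y = Some x \<and> length p = n)"

definition K :: "machine \<Rightarrow> bool list \<Rightarrow> nat" where
  "K U x = Kc U x []"

definition E :: "machine \<Rightarrow> bool list \<Rightarrow> bool list \<Rightarrow> nat" where
  "E U x y = max (Kc U x y) (Kc U y x)"

definition NID :: "machine \<Rightarrow> bool list \<Rightarrow> bool list \<Rightarrow> real" where
  "NID U x y = real (E U x y) / real (max (K U x) (K U y))"

definition computable_approx :: "(bool list \<Rightarrow> bool list \<Rightarrow> nat \<Rightarrow> rat) \<Rightarrow> bool" where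
  "computable_approx f \<longleftrightarrow>
     (\<exists>r. \<forall>x y s. eval r [prod_encode (pair_enc x y, s)] (rat_enc (f x y s)))"

definition dir_le :: "bool \<Rightarrow> real \<Rightarrow> real \<Rightarrow> bool" where
  "dir_le up a b \<longleftrightarrow> (if up then a \<le> b else b \<le> a)"

fun phases :: "bool list \<Rightarrow> nat \<Rightarrow> (nat \<Rightarrow> real) \<Rightarrow> bool" where
  "phases [] a g = True"
| "phases [d] a g = (\<forall>t t'. a \<le> t \<and> t \<le> t' \<longrightarrow> dir_le d (g t) (g t'))"
| "phases (d # d' # ds) a g =
     (\<exists>s\<ge>a. (\<forall>t t'. a \<le> t \<and> t \<le> t' \<and> t' < s \<longrightarrow> dir_le d (g t) (g t'))
            \<and> phases (d' # ds) s g)"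

text \<open>Sigma_n: n alternating phases starting with nondecreasing; Pi_n: starting nonincreasing.\<close>
definition alt_phases :: "bool \<Rightarrow> nat \<Rightarrow> bool list" where
  "alt_phases start n = map (\<lambda>i. if even i then start else \<not> start) [0..<n]"

definition in_Sigma :: "nat \<Rightarrow> (bool list \<Rightarrow> bool list \<Rightarrow> real) \<Rightarrow> bool" where
  "in_Sigma n F \<longleftrightarrow> (\<exists>f. computable_approx f \<and>
     (\<forall>x y. (\<lambda>s. real_of_rat (f x y s)) \<longlonglongrightarrow> F x y) \<and>
     (\<forall>x y. phases (alt_phases True n) 0 (\<lambda>s. real_of_rat (f x y s))))"

end

theory Submission
  imports Defs
begin

text \<open>
  Suppose a computable approximation to NID had only the phases up, down, up on each input. Call its
  values above 1/3 high and those below 1/10 low. We force the pattern high, low, high, low on some pair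
  of strings of length n = 100 k, identified with the numbers below N = 2^n.

  For all pairs x, y outside a small set, K(x|y) is close to n, so the approximation becomes high. Hence
  one can search for a shift q such that, for most x, it becomes high on (x, x + q + i mod N) for all
  i < 2^k. As q is computable from k, this makes E(x, x + q + i) at most about 2 k, which is small
  compared to K(x) for most x. Hence one can search for a single x for which, for all i < 2^k, the
  approximation has become high and later low. Now K(x) and K(x + q + i) are at most about 2 k, whereas
  K(x + q + i | x) is at least k for some i, so one can search for an i for which the approximation
  becomes high again. Then x and x + q + i are both computable from their length, so E is bounded
  while K(x) is unbounded as k grows: the approximation must become low a second time.
\<close>

section \<open>Total recursive functions\<close>

inductive_cases eval_elims:
  "eval Z xs v" "eval S xs v" "eval (Id i) xs v" "eval (Cn f gs) xs v"
  "eval (Pr f g) (0 # xs) v" "eval (Pr f g) (Suc n # xs) v" "eval (Mn f) xs v"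

lemma eval_functional:
  assumes "eval r xs v" "eval r xs w"
  shows "v = w"
  using assms
proof (induction arbitrary: w rule: eval.induct)
  case (eval_Z xs)
  then show ?case by (rule eval_elims(1)) simp
next
  case (eval_S x xs)
  then show ?case by (rule eval_elims(2)) simp
next
  case (eval_Id i xs)
  from eval_Id.prems show ?case by (rule eval_elims(3)) simp
next
  case (eval_Cn xs gs ys f z)
  from eval_Cn.prems obtain ys' where
    ys': "list_all2 (\<lambda>g y. eval g xs y) gs ys'" "eval f ys' w"
    by (rule eval_elims(4))
  have "ys = ys'"
    using eval_Cn.IH(1) ys'(1)
    by (intro nth_equalityI) (auto simp: list_all2_conv_all_nth)
  with ys'(2) eval_Cn.IH(2) show ?case by blast
next
  case (eval_Pr0 f xs y g)
  from eval_Pr0.prems have "eval f xs w" by (rule eval_elims(5))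
  then show ?case by (rule eval_Pr0.IH)
next
  case (eval_PrS f g n xs y z)
  from eval_PrS.prems obtain y' where "eval (Pr f g) (n # xs) y'" "eval g (y' # n # xs) w"
    by (rule eval_elims(6))
  with eval_PrS.IH show ?case by blast
next
  case (eval_Mn f n xs)
  from eval_Mn.prems have w: "eval f (w # xs) 0" "\<forall>m<w. \<exists>v>0. eval f (m # xs) v"
    by (rule eval_elims(7); simp)+
  show ?case
  proof (rule linorder_cases[of n w])
    assume "n < w"
    with w(2) obtain v where "v > 0" "eval f (n # xs) v" by blast
    with eval_Mn.IH(1)[of v] show ?thesis by simp
  next
    assume "w < n"
    with eval_Mn.IH(2) obtain v where "v > 0" "\<forall>u. eval f (w # xs) u \<longrightarrow> v = u" by blast
    with w(1) show ?thesis by blast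
  qed
qed

definition recfn :: "nat \<Rightarrow> (nat list \<Rightarrow> nat) \<Rightarrow> bool" where
  "recfn n F \<longleftrightarrow> (\<exists>r. \<forall>xs. length xs = n \<longrightarrow> eval r xs (F xs))"

definition recpred :: "nat \<Rightarrow> (nat list \<Rightarrow> bool) \<Rightarrow> bool" where
  "recpred n P \<longleftrightarrow> recfn n (\<lambda>xs. of_bool (P xs))"

named_theorems recfn_intros

lemma recfn_cong:
  assumes "recfn n F" "\<And>xs. length xs = n \<Longrightarrow> F xs = G xs"
  shows "recfn n G"
  using assms unfolding recfn_def by auto

lemma recfn_nth [recfn_intros]: "i < n \<Longrightarrow> recfn n (\<lambda>xs. xs ! i)"
  unfolding recfn_def by (auto intro!: exI[of _ "Id i"] eval_Id)

lemma recfn_compose: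
  assumes f: "recfn (length Gs) F" and Gs: "\<And>G. G \<in> set Gs \<Longrightarrow> recfn n G"
  shows "recfn n (\<lambda>xs. F (map (\<lambda>G. G xs) Gs))"
proof -
  obtain r where r: "\<And>xs. length xs = length Gs \<Longrightarrow> eval r xs (F xs)"
    using f unfolding recfn_def by blast
  have "\<forall>G\<in>set Gs. \<exists>r. \<forall>xs. length xs = n \<longrightarrow> eval r xs (G xs)"
    using Gs unfolding recfn_def by blast
  then obtain c where c: "\<forall>G\<in>set Gs. \<forall>xs. length xs = n \<longrightarrow> eval (c G) xs (G xs)"
    by (rule bchoice[THEN exE])
  have "eval (Cn r (map c Gs)) xs (F (map (\<lambda>G. G xs) Gs))" if "length xs = n" for xs
    using that c by (intro eval_Cn[OF _ r]) (auto simp: list_all2_conv_all_nth)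
  then show ?thesis unfolding recfn_def by blast
qed

lemma recfn_compose1:
  assumes "recfn 1 (\<lambda>xs. f (xs ! 0))" "recfn n A"
  shows "recfn n (\<lambda>xs. f (A xs))"
  using recfn_compose[of "[A]" "\<lambda>xs. f (xs ! 0)" n] assms by simp

lemma recfn_compose2:
  assumes "recfn 2 (\<lambda>xs. f (xs ! 0) (xs ! 1))" "recfn n A" "recfn n B"
  shows "recfn n (\<lambda>xs. f (A xs) (B xs))"
  using recfn_compose[of "[A, B]" "\<lambda>xs. f (xs ! 0) (xs ! 1)" n] assms
  by (auto simp: numeral_2_eq_2)

lemma recfn_compose3:
  assumes "recfn 3 (\<lambda>xs. f (xs ! 0) (xs ! 1) (xs ! 2))" "recfn n A" "recfn n B" "recfn n C"
  shows "recfn n (\<lambda>xs. f (A xs) (B xs) (C xs))"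
  using recfn_compose[of "[A, B, C]" "\<lambda>xs. f (xs ! 0) (xs ! 1) (xs ! 2)" n] assms
  by (auto simp: numeral_2_eq_2 numeral_3_eq_3)

lemma recpred_compose4:
  assumes "recpred 4 (\<lambda>xs. P (xs ! 0) (xs ! 1) (xs ! 2) (xs ! 3))"
    "recfn n A" "recfn n B" "recfn n C" "recfn n D"
  shows "recpred n (\<lambda>xs. P (A xs) (B xs) (C xs) (D xs))"
  using recfn_compose[of "[A, B, C, D]" "\<lambda>xs. of_bool (P (xs ! 0) (xs ! 1) (xs ! 2) (xs ! 3))" n] assms
  unfolding recpred_def by (auto simp: numeral_2_eq_2 numeral_3_eq_3 eval_nat_numeral)

lemma recfn_drop:
  assumes "recfn n F"
  shows "recfn (Suc n) (\<lambda>zs. F (tl zs))"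
proof -
  have "recfn (Suc n) (\<lambda>xs. F (map (\<lambda>G. G xs) (map (\<lambda>i xs. xs ! Suc i) [0..<n])))"
    using assms by (intro recfn_compose) (auto intro: recfn_nth)
  then show ?thesis
  proof (rule recfn_cong)
    fix xs :: "nat list"
    assume "length xs = Suc n"
    then have "map (\<lambda>G. G xs) (map (\<lambda>i xs. xs ! Suc i) [0..<n]) = tl xs"
      by (intro nth_equalityI) (auto simp: nth_tl)
    then show "F (map (\<lambda>G. G xs) (map (\<lambda>i xs. xs ! Suc i) [0..<n])) = F (tl xs)" by simp
  qed
qed

lemma recfn_hd [recfn_intros]: "recfn (Suc n) hd"
proof -
  have "recfn (Suc n) (\<lambda>xs. xs ! 0)" by (rule recfn_nth) simp
  then show ?thesis
    by (rule recfn_cong) (auto simp: length_Suc_conv)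
qed

lemma recfn_tl [recfn_intros]:
  "Suc i < n \<Longrightarrow> recfn n (\<lambda>xs. tl xs ! i)"
  "Suc (Suc i) < n \<Longrightarrow> recfn n (\<lambda>xs. tl (tl xs) ! i)"
  "Suc (Suc (Suc i)) < n \<Longrightarrow> recfn n (\<lambda>xs. tl (tl (tl xs)) ! i)"
  "recfn (Suc (Suc m)) (\<lambda>xs. hd (tl xs))"
  "recfn (Suc (Suc (Suc m))) (\<lambda>xs. hd (tl (tl xs)))"
proof -
  note d = recfn_drop
  show "Suc i < n \<Longrightarrow> recfn n (\<lambda>xs. tl xs ! i)"
    using d[OF recfn_nth[of i "n - 1"]] by (cases n) auto
  show "Suc (Suc i) < n \<Longrightarrow> recfn n (\<lambda>xs. tl (tl xs) ! i)"
    using d[OF d[OF recfn_nth[of i "n - 2"]]] by (auto dest!: less_imp_Suc_add)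
  show "Suc (Suc (Suc i)) < n \<Longrightarrow> recfn n (\<lambda>xs. tl (tl (tl xs)) ! i)"
    using d[OF d[OF d[OF recfn_nth[of i "n - 3"]]]] by (auto dest!: less_imp_Suc_add)
  show "recfn (Suc (Suc m)) (\<lambda>xs. hd (tl xs))"
    by (rule d[OF recfn_hd])
  show "recfn (Suc (Suc (Suc m))) (\<lambda>xs. hd (tl (tl xs)))"
    by (rule d[OF d[OF recfn_hd]])
qed

lemma recfn_Suc [recfn_intros]: "recfn n A \<Longrightarrow> recfn n (\<lambda>xs. Suc (A xs))"
proof (rule recfn_compose1[where f = Suc])
  show "recfn 1 (\<lambda>xs. Suc (xs ! 0))"
    unfolding recfn_def by (rule exI[of _ S]) (auto simp: length_Suc_conv intro: eval_S)
qed

lemma recfn_const [recfn_intros]: "recfn n (\<lambda>xs. c)"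
proof (induction c)
  case 0
  show ?case unfolding recfn_def using eval_Z by blast
qed (rule recfn_Suc)

lemma recfn_rec_aux:
  assumes F: "recfn n F" and G: "recfn (Suc (Suc n)) G"
  shows "recfn (Suc n) (\<lambda>zs. rec_nat (F (tl zs)) (\<lambda>m v. G (v # m # tl zs)) (hd zs))"
proof -
  obtain rf rg where r: "\<And>xs. length xs = n \<Longrightarrow> eval rf xs (F xs)"
    "\<And>xs. length xs = Suc (Suc n) \<Longrightarrow> eval rg xs (G xs)"
    using F G unfolding recfn_def by blast
  have "eval (Pr rf rg) (h # xs) (rec_nat (F xs) (\<lambda>m v. G (v # m # xs)) h)"
    if "length xs = n" for h xs
  proof (induction h)
    case 0
    then show ?case using eval_Pr0[OF r(1)[OF that]] by simp
  next
    case (Suc h)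
    then show ?case using eval_PrS[OF Suc r(2)] that by simp
  qed
  then have "eval (Pr rf rg) zs (rec_nat (F (tl zs)) (\<lambda>m v. G (v # m # tl zs)) (hd zs))"
    if "length zs = Suc n" for zs
    using that by (cases zs) auto
  then show ?thesis unfolding recfn_def by blast
qed

lemma recfn_rec_nat:
  assumes H: "recfn n H" and F: "recfn n F"
    and G: "recfn (Suc (Suc n)) (\<lambda>zs. G (hd (tl zs)) (hd zs) (tl (tl zs)))"
  shows "recfn n (\<lambda>xs. rec_nat (F xs) (\<lambda>m v. G m v xs) (H xs))"
proof -
  have "recfn n (\<lambda>xs. rec_nat (F (tl (map (\<lambda>G. G xs) (H # map (\<lambda>i xs. xs ! i) [0..<n]))))
      (\<lambda>m v. G m v (tl (map (\<lambda>G. G xs) (H # map (\<lambda>i xs. xs ! i) [0..<n]))))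
      (hd (map (\<lambda>G. G xs) (H # map (\<lambda>i xs. xs ! i) [0..<n]))))"
    using recfn_rec_aux[OF F G] H by (intro recfn_compose) (auto intro: recfn_nth)
  then show ?thesis
  proof (rule recfn_cong)
    fix xs :: "nat list"
    assume "length xs = n"
    then have "map (\<lambda>G. G xs) (map (\<lambda>i xs. xs ! i) [0..<n]) = xs"
      by (intro nth_equalityI) auto
    then show "rec_nat (F (tl (map (\<lambda>G. G xs) (H # map (\<lambda>i xs. xs ! i) [0..<n]))))
      (\<lambda>m v. G m v (tl (map (\<lambda>G. G xs) (H # map (\<lambda>i xs. xs ! i) [0..<n]))))
      (hd (map (\<lambda>G. G xs) (H # map (\<lambda>i xs. xs ! i) [0..<n])))
      = rec_nat (F xs) (\<lambda>m v. G m v xs) (H xs)" by simp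
  qed
qed

lemma recfn_add [recfn_intros]:
  assumes "recfn n A" "recfn n B"
  shows "recfn n (\<lambda>xs. A xs + B xs)"
proof -
  have "rec_nat b (\<lambda>m v. Suc v) a = a + b" for a b :: nat by (induction a) auto
  with recfn_rec_nat[OF assms, of "\<lambda>m v xs. Suc v"] show ?thesis
    by (auto intro: recfn_intros)
qed

lemma recfn_mult [recfn_intros]:
  assumes "recfn n A" "recfn n B"
  shows "recfn n (\<lambda>xs. A xs * B xs)"
proof (rule recfn_compose2[where f = "(*)"])
  have "rec_nat 0 (\<lambda>m v. v + b) a = a * b" for a b :: nat by (induction a) auto
  moreover have "recfn 2 (\<lambda>xs. rec_nat 0 (\<lambda>m v. v + xs ! 1) (xs ! 0))"
    by (intro recfn_rec_nat recfn_intros) simp_all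
  ultimately show "recfn 2 (\<lambda>xs. xs ! 0 * xs ! 1)" by simp
qed fact+

lemma recfn_diff [recfn_intros]:
  assumes "recfn n A" "recfn n B"
  shows "recfn n (\<lambda>xs. A xs - B xs)"
proof (rule recfn_compose2[where f = "(-)"])
  have "rec_nat 0 (\<lambda>m v. m) a = a - 1" for a :: nat by (induction a) auto
  moreover have "recfn 1 (\<lambda>xs. rec_nat 0 (\<lambda>m v. m) (xs ! 0))"
    by (intro recfn_rec_nat recfn_intros) simp_all
  ultimately have "recfn 1 (\<lambda>xs. xs ! 0 - 1)" by simp
  note pred = recfn_compose1[where f = "\<lambda>x. x - 1", OF this]
  have "rec_nat a (\<lambda>m v. v - 1) b = a - b" for a b :: nat by (induction b) auto
  moreover have "recfn 2 (\<lambda>xs. rec_nat (xs ! 0) (\<lambda>m v. v - 1) (xs ! 1))"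
    by (intro recfn_rec_nat pred recfn_intros) simp_all
  ultimately show "recfn 2 (\<lambda>xs. xs ! 0 - xs ! 1)" by simp
qed fact+

lemma recfn_power [recfn_intros]:
  assumes "recfn n A" "recfn n B"
  shows "recfn n (\<lambda>xs. A xs ^ B xs)"
proof (rule recfn_compose2[where f = "(^)"])
  have "rec_nat 1 (\<lambda>m v. a * v) b = a ^ b" for a b :: nat by (induction b) auto
  moreover have "recfn 2 (\<lambda>xs. rec_nat 1 (\<lambda>m v. xs ! 0 * v) (xs ! 1))"
    by (intro recfn_rec_nat recfn_intros) simp_all
  ultimately show "recfn 2 (\<lambda>xs. (xs ! 0) ^ (xs ! 1))" by simp
qed fact+

lemma recfn_sum [recfn_intros]:
  assumes F: "recfn (Suc n) (\<lambda>zs. F (hd zs) (tl zs))" and H: "recfn n H"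
  shows "recfn n (\<lambda>xs. \<Sum>i<H xs. F i xs)"
proof -
  have eq: "rec_nat 0 (\<lambda>m v. v + F m xs) h = (\<Sum>i<h. F i xs)" for h xs by (induction h) auto
  have "recfn (Suc (Suc n)) (\<lambda>zs. F (hd (tl zs)) (tl (tl zs)))"
    by (rule recfn_drop[OF F])
  then have "recfn n (\<lambda>xs. rec_nat 0 (\<lambda>m v. v + F m xs) (H xs))"
    by (intro recfn_rec_nat H recfn_add recfn_const recfn_hd)
  then show ?thesis by (simp add: eq)
qed

lemma recfn_of_bool [recfn_intros]: "recpred n P \<Longrightarrow> recfn n (\<lambda>xs. of_bool (P xs))"
  unfolding recpred_def .

lemma recpred_not [recfn_intros]:
  assumes "recpred n P"
  shows "recpred n (\<lambda>xs. \<not> P xs)"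
proof -
  have "of_bool (\<not> b) = (1 - of_bool b :: nat)" for b by simp
  then show ?thesis
    using recfn_diff[OF recfn_const[of n 1] assms[unfolded recpred_def]]
    unfolding recpred_def by simp
qed

lemma recpred_conj [recfn_intros]:
  "recpred n P \<Longrightarrow> recpred n Q \<Longrightarrow> recpred n (\<lambda>xs. P xs \<and> Q xs)"
  unfolding recpred_def by (drule (1) recfn_mult) (simp add: of_bool_conj)

lemma recpred_disj [recfn_intros]:
  assumes "recpred n P" "recpred n Q"
  shows "recpred n (\<lambda>xs. P xs \<or> Q xs)"
proof -
  have "recpred n (\<lambda>xs. \<not> (\<not> P xs \<and> \<not> Q xs))" by (intro recfn_intros assms)
  then show ?thesis by simp
qed

lemma recpred_le [recfn_intros]:
  assumes "recfn n A" "recfn n B"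
  shows "recpred n (\<lambda>xs. A xs \<le> B xs)"
proof -
  have "of_bool (a \<le> b) = 1 - (a - b)" for a b :: nat by auto
  moreover have "recfn n (\<lambda>xs. 1 - (A xs - B xs))" by (intro recfn_intros assms)
  ultimately show ?thesis unfolding recpred_def by simp
qed

lemma recpred_less [recfn_intros]:
  assumes "recfn n A" "recfn n B"
  shows "recpred n (\<lambda>xs. A xs < B xs)"
proof -
  have "recpred n (\<lambda>xs. Suc (A xs) \<le> B xs)" by (intro recfn_intros assms)
  then show ?thesis by (simp add: Suc_le_eq)
qed

lemma recpred_eq [recfn_intros]:
  assumes "recfn n A" "recfn n B"
  shows "recpred n (\<lambda>xs. A xs = B xs)"
proof -
  have "recpred n (\<lambda>xs. A xs \<le> B xs \<and> B xs \<le> A xs)" by (intro recfn_intros assms)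
  then show ?thesis by (simp add: eq_iff)
qed

lemma recpred_bex [recfn_intros]:
  assumes P: "recpred (Suc n) (\<lambda>zs. P (hd zs) (tl zs))" and H: "recfn n H"
  shows "recpred n (\<lambda>xs. \<exists>i<H xs. P i xs)"
proof -
  have "recpred n (\<lambda>xs. 0 < (\<Sum>i<H xs. of_bool (P i xs) :: nat))"
    by (intro recpred_less recfn_sum recfn_of_bool recfn_const assms)
  moreover have "0 < (\<Sum>i<h. of_bool (P i xs) :: nat) \<longleftrightarrow> (\<exists>i<h. P i xs)" for h xs
    by (auto simp: zero_less_iff_neq_zero simp del: sum_of_bool_eq)
  ultimately show ?thesis by simp
qed

lemma recpred_ball [recfn_intros]:
  assumes P: "recpred (Suc n) (\<lambda>zs. P (hd zs) (tl zs))" and H: "recfn n H"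
  shows "recpred n (\<lambda>xs. \<forall>i<H xs. P i xs)"
proof -
  have "recpred n (\<lambda>xs. \<not> (\<exists>i<H xs. \<not> P i xs))"
    by (intro recpred_not recpred_bex assms)
  then show ?thesis by simp
qed

lemma eval_Mn_Least:
  assumes r: "\<And>m. eval r (m # xs) (of_bool (\<not> P m))" and "P m"
  shows "eval (Mn r) xs (LEAST m. P m)"
proof (rule eval_Mn)
  show "eval r ((LEAST m. P m) # xs) 0" using r[of "LEAST m. P m"] LeastI[of P, OF \<open>P m\<close>] by simp
  have "eval r (l # xs) 1" if "l < (LEAST m. P m)" for l
    using r[of l] not_less_Least[OF that] by simp
  then show "\<forall>l<LEAST m. P m. \<exists>v>0. eval r (l # xs) v" using zero_less_one by blast
qed

lemma recfn_Least [recfn_intros]: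
  assumes P: "recpred (Suc n) (\<lambda>zs. P (hd zs) (tl zs))"
    and ex: "\<And>xs. length xs = n \<Longrightarrow> \<exists>m. P m xs"
  shows "recfn n (\<lambda>xs. LEAST m. P m xs)"
proof -
  obtain r where r: "\<And>zs. length zs = Suc n \<Longrightarrow> eval r zs (of_bool (\<not> P (hd zs) (tl zs)))"
    using recpred_not[OF P] unfolding recfn_def recpred_def by blast
  have "eval (Mn r) xs (LEAST m. P m xs)" if len: "length xs = n" for xs
  proof -
    obtain m where "P m xs" using ex[OF len] by blast
    then show ?thesis using r[of "_ # xs"] len by (intro eval_Mn_Least) auto
  qed
  then show ?thesis unfolding recfn_def by blast
qed

lemma recfn_div [recfn_intros]:
  assumes "recfn n A" "recfn n B"
  shows "recfn n (\<lambda>xs. A xs div B xs)"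
proof (rule recfn_compose2[where f = "(div)"])
  have ex: "b = 0 \<or> a < Suc (a div b) * b" for a b :: nat
    using div_less_iff_less_mult[of b a "Suc (a div b)"] by auto
  have "(LEAST q. b = 0 \<or> a < Suc q * b) = a div b" for a b :: nat
  proof (rule Least_equality)
    show "b = 0 \<or> a < Suc (a div b) * b" by (rule ex)
    fix q assume "b = 0 \<or> a < Suc q * b"
    then show "a div b \<le> q"
      using div_less_iff_less_mult[of b a "Suc q"] by (cases "b = 0") auto
  qed
  moreover have "recfn 2 (\<lambda>xs. LEAST q. xs ! 1 = 0 \<or> xs ! 0 < Suc q * xs ! 1)"
    by (intro recfn_intros) (use ex in auto)
  ultimately show "recfn 2 (\<lambda>xs. xs ! 0 div xs ! 1)" by simp
qed fact+

lemma recfn_mod [recfn_intros]: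
  assumes "recfn n A" "recfn n B"
  shows "recfn n (\<lambda>xs. A xs mod B xs)"
  unfolding modulo_nat_def by (intro recfn_intros assms)

lemma recfn_prod_encode [recfn_intros]:
  assumes "recfn n A" "recfn n B"
  shows "recfn n (\<lambda>xs. prod_encode (A xs, B xs))"
  unfolding prod_encode_def triangle_def by (simp, intro recfn_intros assms)

lemma recfn_fst_prod_decode [recfn_intros]:
  assumes "recfn n A"
  shows "recfn n (\<lambda>xs. fst (prod_decode (A xs)))"
proof (rule recfn_compose1[where f = "\<lambda>z. fst (prod_decode z)", OF _ assms])
  have ex: "\<exists>b<Suc z. prod_encode (fst (prod_decode z), b) = z" for z
    using le_prod_encode_2[of "snd (prod_decode z)" "fst (prod_decode z)"]
    by (intro exI[of _ "snd (prod_decode z)"]) auto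
  have "(LEAST a. \<exists>b<Suc z. prod_encode (a, b) = z) = fst (prod_decode z)" for z
    by (rule Least_equality, rule ex) auto
  moreover have "recfn 1 (\<lambda>xs. LEAST a. \<exists>b<Suc (xs ! 0). prod_encode (a, b) = xs ! 0)"
    by (intro recfn_intros) (use ex in \<open>blast | simp\<close>)+
  ultimately show "recfn 1 (\<lambda>xs. fst (prod_decode (xs ! 0)))" by simp
qed

lemma recfn_snd_prod_decode [recfn_intros]:
  assumes "recfn n A"
  shows "recfn n (\<lambda>xs. snd (prod_decode (A xs)))"
proof (rule recfn_compose1[where f = "\<lambda>z. snd (prod_decode z)", OF _ assms])
  have ex: "prod_encode (fst (prod_decode z), snd (prod_decode z)) = z" for z
    by simp
  have "(LEAST b. prod_encode (fst (prod_decode z), b) = z) = snd (prod_decode z)" for z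
    by (rule Least_equality, rule ex) (metis order_refl prod_encode_inverse snd_conv)
  moreover have "recfn 1 (\<lambda>xs. LEAST b. prod_encode (fst (prod_decode (xs ! 0)), b) = xs ! 0)"
    by (intro recfn_intros) (use ex in \<open>blast | simp\<close>)+
  ultimately show "recfn 1 (\<lambda>xs. snd (prod_decode (xs ! 0)))" by simp
qed

section \<open>Strings as numbers\<close>

lemma str_enc_inject [simp]: "str_enc xs = str_enc ys \<longleftrightarrow> xs = ys"
proof (induction xs arbitrary: ys)
  case Nil
  show ?case by (cases ys) auto
next
  case (Cons x xs)
  show ?case
  proof (cases ys)
    case (Cons y zs)
    then show ?thesis using Cons.IH[of zs] by (auto split: if_splits; presburger)
  qed auto
qed

lemma str_enc_surj: "\<exists>xs. str_enc xs = n"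
proof (induction n rule: less_induct)
  case (less n)
  show ?case
  proof (cases "n = 0")
    case True
    then show ?thesis by (auto intro: exI[of _ "[]"])
  next
    case False
    then have "(n - 1) div 2 < n" by linarith
    then obtain xs where xs: "str_enc xs = (n - 1) div 2" using less.IH by blast
    have "str_enc (even n # xs) = n" using False by (simp add: xs) presburger
    then show ?thesis by blast
  qed
qed

definition str_dec :: "nat \<Rightarrow> bool list" where
  "str_dec = inv str_enc"

lemma str_enc_dec [simp]: "str_enc (str_dec n) = n"
  unfolding str_dec_def using str_enc_surj[of n] by (auto intro: f_inv_into_f)

lemma str_dec_enc [simp]: "str_dec (str_enc xs) = xs"
  using str_enc_dec[of "str_enc xs"] by (simp only: str_enc_inject)

lemma str_dec_inject [simp]: "str_dec m = str_dec n \<longleftrightarrow> m = n"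
  by (metis str_enc_dec)

lemma str_enc_bounds: "2 ^ length xs \<le> Suc (str_enc xs)" "Suc (str_enc xs) < 2 ^ Suc (length xs)"
  by (induction xs) auto

lemma length_str_dec_eqI:
  assumes "2 ^ k \<le> Suc n" "Suc n < 2 ^ Suc k"
  shows "length (str_dec n) = k"
proof -
  have "(2::nat) ^ k < 2 ^ Suc (length (str_dec n))" "(2::nat) ^ length (str_dec n) < 2 ^ Suc k"
    using assms str_enc_bounds[of "str_dec n"] by simp_all
  then show ?thesis by (simp del: power_Suc)
qed

lemma recfn_length_str_dec [recfn_intros]:
  assumes "recfn n A"
  shows "recfn n (\<lambda>xs. length (str_dec (A xs)))"
proof (rule recfn_compose1[where f = "\<lambda>z. length (str_dec z)", OF _ assms])
  have ex: "Suc z < 2 ^ Suc (length (str_dec z))" for z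
    using str_enc_bounds(2)[of "str_dec z"] by simp
  have "(LEAST k. Suc z < 2 ^ Suc k) = length (str_dec z)" for z
  proof (rule Least_equality, rule ex)
    fix k assume "Suc z < 2 ^ Suc k"
    then have "(2::nat) ^ length (str_dec z) < 2 ^ Suc k"
      using str_enc_bounds(1)[of "str_dec z"] by simp
    then show "length (str_dec z) \<le> k" by (simp del: power_Suc)
  qed
  moreover have "recfn 1 (\<lambda>xs. LEAST k. Suc (xs ! 0) < 2 ^ Suc k)"
    by (intro recfn_intros) (use ex in auto)
  ultimately show "recfn 1 (\<lambda>xs. length (str_dec (xs ! 0)))" by simp
qed

section \<open>Upper and lower bounds on complexity\<close>

definition self_delim :: "bool list \<Rightarrow> bool list" where
  "self_delim w = replicate (length w) True @ False # w"

lemma length_self_delim: "length (self_delim w) = 2 * length w + 1"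
  unfolding self_delim_def by simp

lemma prefix_self_delim:
  assumes "prefix (self_delim v) (self_delim w)"
  shows "v = w"
proof -
  have "m = n \<and> prefix v w"
    if "prefix (replicate m True @ False # v) (replicate n True @ False # w)" for m n
    using that
  proof (induction m arbitrary: n)
    case 0
    then show ?case by (cases n) auto
  next
    case (Suc m)
    then show ?case by (cases n) auto
  qed
  from this[of "length v" "length w"] assms show ?thesis
    unfolding self_delim_def by (auto simp: prefix_def)
qed

lemma str_enc_self_delim: "str_enc (self_delim w) + 2 = 2 ^ length w * (3 + 2 * str_enc w)"
proof -
  have "str_enc (replicate m True @ False # w) + 2 = 2 ^ m * (3 + 2 * str_enc w)" for m
    by (induction m) (auto simp: algebra_simps)
  then show ?thesis unfolding self_delim_def .
qed

lemma self_delim_machine_computable: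
  assumes "recfn 2 (\<lambda>xs. \<phi> (xs ! 0) (xs ! 1))"
  shows "\<exists>r. \<forall>p y v. eval r [pair_enc p y] v \<longleftrightarrow>
    (\<exists>w. p = self_delim w \<and> v = \<phi> (str_enc w) (str_enc y))"
proof -
  obtain r where r: "\<And>xs. length xs = 2 \<Longrightarrow> eval r xs (\<phi> (xs ! 0) (xs ! 1))"
    using assms unfolding recfn_def by blast
  have "recfn 1 (\<lambda>xs. snd (prod_decode (xs ! 0)))" by (intro recfn_intros) simp
  then obtain s where s: "\<And>xs. length xs = 1 \<Longrightarrow> eval s xs (snd (prod_decode (xs ! 0)))"
    unfolding recfn_def by blast
  have "recfn 2 (\<lambda>xs. of_bool (\<not> (fst (prod_decode (xs ! 1)) + 2 =
      2 ^ length (str_dec (xs ! 0)) * (3 + 2 * xs ! 0))))"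
    by (intro recfn_intros) simp_all
  then obtain t where t: "\<And>xs. length xs = 2 \<Longrightarrow>
      eval t xs (of_bool (\<not> (fst (prod_decode (xs ! 1)) + 2 =
      2 ^ length (str_dec (xs ! 0)) * (3 + 2 * xs ! 0))))"
    unfolding recfn_def by blast
  have t': "eval t [m, pair_enc p y] (of_bool (\<not> p = self_delim (str_dec m)))" for m p y
  proof -
    have "str_enc p + 2 = 2 ^ length (str_dec m) * (3 + 2 * m) \<longleftrightarrow> p = self_delim (str_dec m)"
      using str_enc_self_delim[of "str_dec m"] str_enc_inject[of p "self_delim (str_dec m)"]
      by (simp del: str_enc_inject) linarith
    with t[of "[m, pair_enc p y]"] show ?thesis by (simp add: pair_enc_def)
  qed
  have "eval (Cn r [Mn t, s]) [pair_enc p y] v \<longleftrightarrow>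
    (\<exists>w. p = self_delim w \<and> v = \<phi> (str_enc w) (str_enc y))" for p y v
  proof
    assume "eval (Cn r [Mn t, s]) [pair_enc p y] v"
    then obtain ys where ys: "list_all2 (\<lambda>g y'. eval g [pair_enc p y] y') [Mn t, s] ys" "eval r ys v"
      by (rule eval_elims(4))
    then obtain a b where ab: "ys = [a, b]" "eval (Mn t) [pair_enc p y] a" "eval s [pair_enc p y] b"
      by (auto simp: list_all2_Cons1)
    from ab(2) have "eval t [a, pair_enc p y] 0" by (rule eval_elims(7))
    from eval_functional[OF this t'] have "p = self_delim (str_dec a)" by simp
    moreover have "b = str_enc y"
      using eval_functional[OF ab(3) s] by (simp add: pair_enc_def)
    moreover have "v = \<phi> a b"
      using eval_functional[OF ys(2) r] ab(1) by simp
    ultimately show "\<exists>w. p = self_delim w \<and> v = \<phi> (str_enc w) (str_enc y)"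
      by (intro exI[of _ "str_dec a"]) simp
  next
    assume "\<exists>w. p = self_delim w \<and> v = \<phi> (str_enc w) (str_enc y)"
    then obtain w where w: "p = self_delim w" "v = \<phi> (str_enc w) (str_enc y)" by blast
    have eq: "p = self_delim (str_dec m) \<longleftrightarrow> m = str_enc w" for m
      using prefix_self_delim[of w "str_dec m"] w(1) by auto
    have "eval (Mn t) [pair_enc p y] (LEAST m. p = self_delim (str_dec m))"
      by (rule eval_Mn_Least[where P = "\<lambda>m. p = self_delim (str_dec m)" and m = "str_enc w"])
        (use t' w in auto)
    then have "eval (Mn t) [pair_enc p y] (str_enc w)"
      unfolding eq by (simp add: Least_equality)
    moreover have "eval s [pair_enc p y] (str_enc y)"
      using s[of "[pair_enc p y]"] by (simp add: pair_enc_def)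
    moreover have "eval r [str_enc w, str_enc y] v"
      using r[of "[str_enc w, str_enc y]"] w(2) by simp
    ultimately show "eval (Cn r [Mn t, s]) [pair_enc p y] v"
      by (intro eval_Cn[of _ _ "[str_enc w, str_enc y]"]) auto
  qed
  then show ?thesis by blast
qed

lemma universal_describes:
  assumes U: "universal_pf_machine U" and \<phi>: "recfn 2 (\<lambda>xs. \<phi> (xs ! 0) (xs ! 1))"
  shows "\<exists>c. \<forall>w y. \<exists>q. U q y = Some (str_dec (\<phi> (str_enc w) (str_enc y))) \<and>
    length q \<le> 2 * length w + c"
proof -
  define M where "M p y = (if \<exists>w. p = self_delim w
     then Some (str_dec (\<phi> (str_enc (THE w. p = self_delim w)) (str_enc y))) else None)" for p y
  have inj: "self_delim v = self_delim w \<longleftrightarrow> v = w" for v w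
    using prefix_self_delim[of v w] by auto
  have M: "M p y = Some x \<longleftrightarrow> (\<exists>w. p = self_delim w \<and> x = str_dec (\<phi> (str_enc w) (str_enc y)))"
    for p y x
    unfolding M_def by (auto simp: inj)
  have "prefix_free_machine M"
    unfolding prefix_free_machine_def using M by (auto dest: prefix_self_delim)
  moreover have "computable_machine M"
  proof -
    have "(\<exists>x. M p y = Some x \<and> v = str_enc x) \<longleftrightarrow>
        (\<exists>w. p = self_delim w \<and> v = \<phi> (str_enc w) (str_enc y))" for p y v
      unfolding M by auto
    then show ?thesis
      unfolding computable_machine_def using self_delim_machine_computable[OF \<phi>] by simp
  qed
  ultimately obtain c where
    c: "\<And>p y x. M p y = Some x \<Longrightarrow> \<exists>q. U q y = Some x \<and> length q \<le> length p + c"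
    using U unfolding universal_pf_machine_def by blast
  have "\<exists>q. U q y = Some (str_dec (\<phi> (str_enc w) (str_enc y))) \<and> length q \<le> 2 * length w + (1 + c)"
    for w y
    using c[of "self_delim w" y] M by (auto simp: length_self_delim)
  then show ?thesis by blast
qed

lemma universal_total:
  assumes "universal_pf_machine U"
  shows "\<exists>p. U p y = Some x"
proof -
  have "recfn 2 (\<lambda>xs. xs ! 0)" by (intro recfn_intros) simp
  from universal_describes[OF assms, of "\<lambda>w y. w", OF this]
  obtain c where "\<forall>w y. \<exists>q. U q y = Some (str_dec (str_enc w)) \<and> length q \<le> 2 * length w + c"
    by (rule exE)
  from this[rule_format, of y x] show ?thesis by auto
qed

lemma Kc_witness:
  assumes "universal_pf_machine U"
  shows "\<exists>p. U p y = Some x \<and> length p = Kc U x y"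
proof -
  have "\<exists>n p. U p y = Some x \<and> length p = n" using universal_total[OF assms, of y x] by simp
  then show ?thesis unfolding Kc_def by (rule LeastI_ex)
qed

lemma Kc_upper:
  assumes U: "universal_pf_machine U" and \<phi>: "recfn 2 (\<lambda>xs. \<phi> (xs ! 0) (xs ! 1))"
  shows "\<exists>c. \<forall>w y. Kc U (str_dec (\<phi> (str_enc w) (str_enc y))) y \<le> 2 * length w + c"
proof -
  obtain c where c: "\<forall>w y. \<exists>q. U q y = Some (str_dec (\<phi> (str_enc w) (str_enc y))) \<and>
    length q \<le> 2 * length w + c"
    using universal_describes[OF assms] by (rule exE)
  have "Kc U (str_dec (\<phi> (str_enc w) (str_enc y))) y \<le> 2 * length w + c" for w y
  proof -
    obtain q where "U q y = Some (str_dec (\<phi> (str_enc w) (str_enc y)))" "length q \<le> 2 * length w + c"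
      using c[rule_format, of y w] by (elim exE conjE)
    then show ?thesis unfolding Kc_def by (intro Least_le[THEN order_trans]) auto
  qed
  then show ?thesis by blast
qed

lemma Kc_pos:
  assumes "universal_pf_machine U"
  shows "Kc U x y > 0"
proof (rule ccontr)
  assume "\<not> Kc U x y > 0"
  then have x: "U [] y = Some x" using Kc_witness[OF assms, of y x] by auto
  obtain p where p: "U p y = Some (True # x)" using universal_total[OF assms] by blast
  have "prefix_free_machine U" using assms unfolding universal_pf_machine_def by blast
  then have "U [] y \<noteq> None \<and> U p y \<noteq> None \<and> prefix [] p \<longrightarrow> [] = p"
    unfolding prefix_free_machine_def by (elim allE)
  with x p show False by auto
qed

lemma card_Kc_less:
  assumes "universal_pf_machine U"
  shows "finite {x. Kc U x y < m}" "card {x. Kc U x y < m} < 2 ^ m"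
proof -
  let ?P = "{p :: bool list. length p < m}"
  have P: "?P = str_dec ` {..<2 ^ m - 1}"
  proof (intro equalityI subsetI)
    fix p :: "bool list" assume "p \<in> ?P"
    then have "(2::nat) ^ Suc (length p) \<le> 2 ^ m" by (intro power_increasing) auto
    with str_enc_bounds(2)[of p] have "str_enc p < 2 ^ m - 1" by simp
    then show "p \<in> str_dec ` {..<2 ^ m - 1}" by (metis imageI lessThan_iff str_dec_enc)
  next
    fix p assume "p \<in> str_dec ` {..<2 ^ m - 1}"
    then have "Suc (str_enc p) < 2 ^ m" by auto
    with str_enc_bounds(1)[of p] have "(2::nat) ^ length p < 2 ^ m" by linarith
    then show "p \<in> ?P" by simp
  qed
  have sub: "{x. Kc U x y < m} \<subseteq> (\<lambda>p. the (U p y)) ` ?P"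
  proof
    fix x assume "x \<in> {x. Kc U x y < m}"
    with Kc_witness[OF assms, of y x] obtain p where "U p y = Some x" "length p < m" by auto
    then show "x \<in> (\<lambda>p. the (U p y)) ` ?P" by force
  qed
  have fin: "finite ?P" unfolding P by simp
  have "card ?P \<le> card {..<2 ^ m - 1 :: nat}" unfolding P by (rule card_image_le) simp
  then have "card ?P \<le> 2 ^ m - 1" by simp
  moreover have "card {x. Kc U x y < m} \<le> card ?P"
    using surj_card_le[OF fin sub] .
  ultimately have "card {x. Kc U x y < m} \<le> 2 ^ m - 1" by linarith
  moreover have "(0::nat) < 2 ^ m" by simp
  ultimately show "card {x. Kc U x y < m} < 2 ^ m" by linarith
  show "finite {x. Kc U x y < m}" using finite_subset[OF sub] fin by blast
qed

section \<open>Counting\<close>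

lemma bounded_witnesses:
  fixes P :: "'a \<Rightarrow> nat \<Rightarrow> bool"
  assumes "finite I" "\<And>i. i \<in> I \<Longrightarrow> \<exists>t. P i t"
  shows "\<exists>s. \<forall>i\<in>I. \<exists>t<s. P i t"
proof -
  from assms(2) have "\<forall>i\<in>I. \<exists>t. P i t" by blast
  then obtain g where g: "\<forall>i\<in>I. P i (g i)" by (rule bchoice[THEN exE])
  have "g i < Suc (sum g I)" if "i \<in> I" for i
    using member_le_sum[OF that _ assms(1), of g] by simp
  with g show ?thesis by blast
qed

lemma add_mod_inj:
  fixes c i j N :: nat
  assumes "(c + i) mod N = (c + j) mod N" "i < N" "j < N"
  shows "i = j"
proof -
  have "i = j" if "(c + i) mod N = (c + j) mod N" "j \<le> i" "i < N" for i j :: nat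
  proof -
    have "N dvd (c + i) - (c + j)" using that by (simp add: mod_eq_dvd_iff_nat)
    then show ?thesis using that by (auto dest: dvd_imp_le)
  qed
  from this[of i j] this[of j i] assms show ?thesis by (cases "j \<le> i") simp_all
qed

lemma sum_mod_shift:
  fixes c N :: nat
  shows "(\<Sum>q<N. g ((c + q) mod N)) = (\<Sum>b<N. g b)"
proof (rule sum.reindex_bij_betw)
  have inj: "inj_on (\<lambda>q. (c + q) mod N) {..<N}"
    by (rule inj_onI) (auto intro: add_mod_inj)
  moreover have "(\<lambda>q. (c + q) mod N) ` {..<N} \<subseteq> {..<N}" by auto
  ultimately show "bij_betw (\<lambda>q. (c + q) mod N) {..<N} {..<N}"
    unfolding bij_betw_def using endo_inj_surj[OF finite_lessThan] by blast
qed

lemma exists_good_shift: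
  fixes N m B :: nat and bad :: "nat \<Rightarrow> nat \<Rightarrow> bool"
  assumes N: "0 < N" and B: "\<And>b. b < N \<Longrightarrow> card {a. a < N \<and> bad a b} \<le> B" and mB: "4 * m * B \<le> N"
  shows "\<exists>q. 3 * N \<le> 4 * card {a. a < N \<and> (\<forall>i<m. \<not> bad a ((a + q + i) mod N))}"
proof (rule ccontr)
  assume neg: "\<not> ?thesis"
  define X where "X q = {a. a < N \<and> (\<exists>i<m. bad a ((a + q + i) mod N))}" for q
  have X: "N < 4 * card (X q)" for q
  proof -
    let ?G = "{a. a < N \<and> (\<forall>i<m. \<not> bad a ((a + q + i) mod N))}"
    have "{..<N} = ?G \<union> X q" unfolding X_def by auto
    from arg_cong[OF this, of card] have "N = card (?G \<union> X q)" by simp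
    then have "N \<le> card ?G + card (X q)" using card_Un_le[of ?G "X q"] by simp
    moreover have "4 * card ?G < 3 * N" using neg by (simp add: not_le)
    ultimately show ?thesis by linarith
  qed
  have le: "card (X q) \<le> (\<Sum>a<N. \<Sum>i<m. of_bool (bad a ((a + i + q) mod N)))" for q
  proof -
    have "card (X q) = (\<Sum>a<N. of_bool (\<exists>i<m. bad a ((a + q + i) mod N)))"
      unfolding X_def by (simp add: Collect_conj_eq lessThan_def)
    also have "\<dots> \<le> (\<Sum>a<N. \<Sum>i<m. of_bool (bad a ((a + i + q) mod N)))"
    proof (rule sum_mono)
      fix a
      show "of_bool (\<exists>i<m. bad a ((a + q + i) mod N))
          \<le> (\<Sum>i<m. of_bool (bad a ((a + i + q) mod N)) :: nat)"
      proof (cases "\<exists>i<m. bad a ((a + q + i) mod N)")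
        case True
        then obtain i where "i < m" "bad a ((a + i + q) mod N)" by (auto simp: ac_simps)
        then show ?thesis
          using member_le_sum[of i "{..<m}" "\<lambda>i. of_bool (bad a ((a + i + q) mod N)) :: nat"]
          by (simp del: sum_of_bool_eq)
      next
        case False
        show ?thesis unfolding of_bool_eq_0_iff[THEN iffD2, OF False] by simp
      qed
    qed
    finally show ?thesis .
  qed
  have "N * N = (\<Sum>q<N. N)" by simp
  also have "\<dots> < (\<Sum>q<N. 4 * card (X q))"
    using N X by (intro sum_strict_mono) auto
  also have "\<dots> \<le> 4 * (\<Sum>q<N. \<Sum>a<N. \<Sum>i<m. of_bool (bad a ((a + i + q) mod N)))"
    unfolding sum_distrib_left[symmetric] by (intro mult_left_mono sum_mono le) simp
  also have "(\<Sum>q<N. \<Sum>a<N. \<Sum>i<m. of_bool (bad a ((a + i + q) mod N)) :: nat)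
      = (\<Sum>a<N. \<Sum>q<N. \<Sum>i<m. of_bool (bad a ((a + i + q) mod N)))"
    by (rule sum.swap)
  also have "\<dots> = (\<Sum>a<N. \<Sum>i<m. \<Sum>q<N. of_bool (bad a ((a + i + q) mod N)))"
    by (intro sum.cong refl sum.swap)
  also have "\<dots> = (\<Sum>a<N. \<Sum>i<m. \<Sum>b<N. of_bool (bad a b))"
    by (intro sum.cong refl sum_mod_shift[where g = "\<lambda>b. of_bool (bad _ b)"])
  also have "\<dots> = m * (\<Sum>a<N. \<Sum>b<N. of_bool (bad a b))"
    by (simp add: sum_distrib_left del: sum_of_bool_eq)
  also have "(\<Sum>a<N. \<Sum>b<N. of_bool (bad a b)) = (\<Sum>b<N. \<Sum>a<N. of_bool (bad a b) :: nat)"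
    by (rule sum.swap)
  also have "\<dots> \<le> (\<Sum>b<N. B)"
    using B by (intro sum_mono) (simp add: Collect_conj_eq lessThan_def)
  also have "4 * (m * (\<Sum>b<N. B)) = (4 * m * B) * N" by simp
  also have "\<dots> \<le> N * N" using mB by (rule mult_right_mono) simp
  finally show False by simp
qed

definition word :: "nat \<Rightarrow> nat \<Rightarrow> bool list" where
  "word n a = str_dec (2 ^ n - 1 + a)"

lemma str_enc_word [simp]: "str_enc (word n a) = 2 ^ n - 1 + a"
  unfolding word_def by simp

lemma length_word [simp]:
  assumes "a < 2 ^ n"
  shows "length (word n a) = n"
proof -
  have "Suc (2 ^ n - 1 + a) = 2 ^ n + a" by simp
  then show ?thesis unfolding word_def using assms by (intro length_str_dec_eqI) auto
qed

lemma word_inject [simp]: "word n a = word n b \<longleftrightarrow> a = b"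
proof -
  have "(0::nat) < 2 ^ n" by simp
  then show ?thesis unfolding word_def str_dec_inject by linarith
qed

lemma card_word_Kc_less:
  assumes "universal_pf_machine U"
  shows "card {a. a < N \<and> Kc U (word n a) y < m} < 2 ^ m"
proof -
  have "card {a. a < N \<and> Kc U (word n a) y < m} \<le> card {x. Kc U x y < m}"
    by (rule card_inj_on_le[where f = "word n"]) (auto simp: inj_on_def card_Kc_less[OF assms])
  with card_Kc_less(2)[OF assms, of y m] show ?thesis by (rule order.strict_trans1[rotated])
qed

lemma Kc_le_double_length:
  assumes "universal_pf_machine U"
  shows "\<exists>c. \<forall>x y. Kc U x y \<le> 2 * length x + c"
proof -
  have "recfn 2 (\<lambda>xs. xs ! 0)" by (intro recfn_intros) simp
  from Kc_upper[OF assms, of "\<lambda>w y. w", OF this] show ?thesis by simp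
qed

lemma NID_gt_third:
  assumes "universal_pf_machine U" and "K U x < 3 * E U x y" "K U y < 3 * E U x y"
  shows "NID U x y > 1 / 3"
proof -
  have "0 < K U x" unfolding K_def by (rule Kc_pos[OF assms(1)])
  then have pos: "0 < max (K U x) (K U y)" by simp
  have "max (K U x) (K U y) < 3 * E U x y" using assms by simp
  then have "real (max (K U x) (K U y)) < real (3 * E U x y)" unfolding of_nat_less_iff .
  with pos show ?thesis unfolding NID_def by (simp add: divide_simps del: of_nat_max)
qed

lemma NID_less_tenth:
  assumes "10 * E U x y < max (K U x) (K U y)"
  shows "NID U x y < 1 / 10"
proof -
  have "real (10 * E U x y) < real (max (K U x) (K U y))" using assms unfolding of_nat_less_iff .
  moreover from this have "0 < real (max (K U x) (K U y))" by simp
  ultimately show ?thesis unfolding NID_def by (simp add: divide_simps del: of_nat_max)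
qed

text \<open>Adding the disjunct k < k0 makes the search total, so that partial functions never occur.\<close>
lemma recfn_search:
  assumes P: "recpred 3 (\<lambda>xs. P (xs ! 0) (xs ! 1) (xs ! 2))"
    and ex: "\<And>k. k \<ge> k0 \<Longrightarrow> \<exists>v s. P k v s"
  shows "\<exists>F. recfn 1 (\<lambda>xs. F (xs ! 0)) \<and> (\<forall>k\<ge>k0. \<exists>s. P k (F k) s)"
proof -
  define T where "T k = (LEAST t. k < k0 \<or> P k (fst (prod_decode t)) (snd (prod_decode t)))" for k :: nat
  have ex': "\<exists>t. k < k0 \<or> P k (fst (prod_decode t)) (snd (prod_decode t))" for k
  proof (cases "k < k0")
    case False
    then obtain v s where "P k v s" using ex[of k] by auto
    then have "P k (fst (prod_decode (prod_encode (v, s)))) (snd (prod_decode (prod_encode (v, s))))" by simp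
    then show ?thesis by blast
  qed simp
  have P': "recpred n (\<lambda>xs. P (A xs) (B xs) (C xs))" if "recfn n A" "recfn n B" "recfn n C" for n A B C
    using recfn_compose3[where f = "\<lambda>a b c. of_bool (P a b c)", OF P[unfolded recpred_def] that]
    unfolding recpred_def .
  have "recfn 1 (\<lambda>xs. T (xs ! 0))"
    unfolding T_def by (intro recfn_intros P') (rule ex' | simp)+
  then have "recfn 1 (\<lambda>xs. fst (prod_decode (T (xs ! 0))))" by (rule recfn_fst_prod_decode)
  moreover have "\<exists>s. P k (fst (prod_decode (T k))) s" if "k \<ge> k0" for k
    using LeastI_ex[OF ex'[of k]] that unfolding T_def[symmetric] by auto
  ultimately show ?thesis by (intro exI[of _ "\<lambda>k. fst (prod_decode (T k))"]) blast
qed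

section \<open>Forcing the oscillations\<close>

lemma shift_search:
  assumes U: "universal_pf_machine U"
    and Hi: "recpred 4 (\<lambda>xs. Hi (xs ! 0) (xs ! 1) (xs ! 2) (xs ! 3))"
    and NID_Hi: "\<forall>n a b. NID U (word n a) (word n b) > 1 / 3 \<longrightarrow>
      (\<forall>\<^sub>F t in sequentially. Hi n a b t)"
  shows "\<exists>Q k0. recfn 1 (\<lambda>xs. Q (xs ! 0)) \<and> (\<forall>k\<ge>k0. 3 * 2 ^ (100 * k) \<le>
    4 * card {a. a < 2 ^ (100 * k) \<and> (\<forall>i<2 ^ k. \<exists>t. Hi (100 * k) a ((a + Q k + i) mod 2 ^ (100 * k)) t)})"
proof -
  have ex_Hi: "\<exists>t. Hi n a b t" if "NID U (word n a) (word n b) > 1 / 3" for n a b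
    using NID_Hi[rule_format, OF that] unfolding eventually_sequentially by blast
  obtain c where c: "\<forall>x y. Kc U x y \<le> 2 * length x + c"
    using Kc_le_double_length[OF U] by (rule exE)
  define P where "P k q s \<longleftrightarrow> 3 * 2 ^ (100 * k) \<le> 4 * (\<Sum>a<2 ^ (100 * k).
    of_bool (\<forall>i<2 ^ k. \<exists>t<s. Hi (100 * k) a ((a + q + i) mod 2 ^ (100 * k)) t) :: nat)" for k q s :: nat
  have sum_eq: "(\<Sum>a<N. of_bool (R a)) = card {a. a < N \<and> R a}" for N :: nat and R
    by (simp add: Collect_conj_eq lessThan_def)
  note Hi' = recpred_compose4[where P = Hi, OF Hi]
  have "recpred 3 (\<lambda>xs. P (xs ! 0) (xs ! 1) (xs ! 2))"
    unfolding P_def by (intro recfn_intros Hi') simp_all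
  moreover have "\<exists>q s. P k q s" if k: "k \<ge> c + 12" for k
  proof -
    let ?n = "100 * k"
    let ?N = "2 ^ ?n :: nat"
    define bad where "bad a b \<longleftrightarrow> Kc U (word ?n a) (word ?n b) < ?n - k - 2" for a b
    have "card {a. a < ?N \<and> bad a b} \<le> 2 ^ (?n - k - 2)" for b
      unfolding bad_def using card_word_Kc_less[OF U, of ?N ?n "word ?n b" "?n - k - 2"] by simp
    moreover have "4 * 2 ^ k * 2 ^ (?n - k - 2) \<le> ?N"
    proof -
      have "?n = 2 + k + (?n - k - 2)" using k by simp
      then have "?N = 2 ^ (2 + k + (?n - k - 2))" by (rule arg_cong)
      then show ?thesis by (simp only: power_add) simp
    qed
    ultimately obtain q where
      q: "3 * ?N \<le> 4 * card {a. a < ?N \<and> (\<forall>i<2 ^ k. \<not> bad a ((a + q + i) mod ?N))}"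
      using exists_good_shift[of ?N bad "2 ^ (?n - k - 2)" "2 ^ k"] by auto
    let ?G = "{a. a < ?N \<and> (\<forall>i<2 ^ k. \<not> bad a ((a + q + i) mod ?N))}"
    have "\<exists>t. Hi ?n (fst p) ((fst p + q + snd p) mod ?N) t" if p: "p \<in> ?G \<times> {..<2 ^ k}" for p
    proof (rule ex_Hi, rule NID_gt_third[OF U])
      let ?x = "word ?n (fst p)" and ?y = "word ?n ((fst p + q + snd p) mod ?N)"
      have "?n - k - 2 \<le> Kc U ?x ?y" using p unfolding bad_def by (auto simp: not_less)
      then have "?n - k - 2 \<le> E U ?x ?y" unfolding E_def by simp
      moreover have "K U ?x \<le> 2 * ?n + c" "K U ?y \<le> 2 * ?n + c"
        using c[rule_format, of ?x "[]"] c[rule_format, of ?y "[]"] p unfolding K_def by auto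
      ultimately show "K U ?x < 3 * E U ?x ?y" "K U ?y < 3 * E U ?x ?y"
        using k by linarith+
    qed
    then obtain s where
      s: "\<forall>p\<in>?G \<times> {..<2 ^ k}. \<exists>t<s. Hi ?n (fst p) ((fst p + q + snd p) mod ?N) t"
      using bounded_witnesses[of "?G \<times> {..<2 ^ k}"
          "\<lambda>p. Hi ?n (fst p) ((fst p + q + snd p) mod ?N)"] by auto
    have "card ?G \<le> card {a. a < ?N \<and> (\<forall>i<2 ^ k. \<exists>t<s. Hi ?n a ((a + q + i) mod ?N) t)}"
      using s by (intro card_mono) auto
    with q have "P k q s" unfolding P_def sum_eq by linarith
    then show ?thesis by blast
  qed
  ultimately obtain Q where Q: "recfn 1 (\<lambda>xs. Q (xs ! 0))" "\<forall>k\<ge>c + 12. \<exists>s. P k (Q k) s"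
    using recfn_search[of P "c + 12"] by auto
  have "3 * 2 ^ (100 * k) \<le> 4 * card {a. a < 2 ^ (100 * k) \<and>
      (\<forall>i<2 ^ k. \<exists>t. Hi (100 * k) a ((a + Q k + i) mod 2 ^ (100 * k)) t)}" (is "_ \<le> 4 * card ?R")
    if "k \<ge> c + 12" for k
  proof -
    from Q(2) that obtain s where s: "P k (Q k) s" by blast
    have "card {a. a < 2 ^ (100 * k) \<and> (\<forall>i<2 ^ k. \<exists>t<s. Hi (100 * k) a ((a + Q k + i) mod 2 ^ (100 * k)) t)}
        \<le> card ?R"
      by (intro card_mono) auto
    with s show ?thesis unfolding P_def sum_eq by linarith
  qed
  with Q(1) show ?thesis by blast
qed

text \<open>Multiplication by N - 1 replaces the truncated subtraction of d.\<close>
lemma shift_back: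
  fixes a d N :: nat
  assumes "a < N"
  shows "((a + d) mod N + d * (N - 1)) mod N = a"
proof -
  have "((a + d) mod N + d * (N - 1)) mod N = (a + d + d * (N - 1)) mod N"
    by (simp add: mod_simps)
  also have "a + d + d * (N - 1) = a + d * N" using assms by (cases N) auto
  finally show ?thesis using assms by simp
qed

lemma base_point_search:
  assumes U: "universal_pf_machine U"
    and Hi: "recpred 4 (\<lambda>xs. Hi (xs ! 0) (xs ! 1) (xs ! 2) (xs ! 3))"
    and Lo: "recpred 4 (\<lambda>xs. Lo (xs ! 0) (xs ! 1) (xs ! 2) (xs ! 3))"
    and NID_Lo: "\<forall>n a b. NID U (word n a) (word n b) < 1 / 10 \<longrightarrow>
      (\<forall>\<^sub>F t in sequentially. Lo n a b t)"
    and Q: "recfn 1 (\<lambda>xs. Q (xs ! 0))"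
    and Q_good: "\<forall>k\<ge>k0. 3 * 2 ^ (100 * k) \<le>
    4 * card {a. a < 2 ^ (100 * k) \<and> (\<forall>i<2 ^ k. \<exists>t. Hi (100 * k) a ((a + Q k + i) mod 2 ^ (100 * k)) t)}"
  shows "\<exists>A k1. recfn 1 (\<lambda>xs. A (xs ! 0)) \<and> (\<forall>k\<ge>k1. A k < 2 ^ (100 * k) \<and>
    (\<forall>i<2 ^ k. \<exists>u. Lo (100 * k) (A k) ((A k + Q k + i) mod 2 ^ (100 * k)) u \<and>
      (\<exists>v<u. Hi (100 * k) (A k) ((A k + Q k + i) mod 2 ^ (100 * k)) v)))"
proof -
  note Q' = recfn_compose1[where f = Q, OF Q]
  define fwd where "fwd w x = (let k = length (str_dec w); N = 2 ^ (100 * k) in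
      N - 1 + ((Suc x - N) + (Q k + (Suc w - 2 ^ k))) mod N)" for w x
  define bwd where "bwd w y = (let k = length (str_dec w); N = 2 ^ (100 * k) in
      N - 1 + ((Suc y - N) + (Q k + (Suc w - 2 ^ k)) * (N - 1)) mod N)" for w y
  have "recfn 2 (\<lambda>xs. fwd (xs ! 0) (xs ! 1))" "recfn 2 (\<lambda>xs. bwd (xs ! 0) (xs ! 1))"
    unfolding fwd_def bwd_def Let_def by (intro recfn_intros Q'; simp)+
  then obtain c d where
    c: "\<forall>w y. Kc U (str_dec (fwd (str_enc w) (str_enc y))) y \<le> 2 * length w + c" and
    d: "\<forall>w y. Kc U (str_dec (bwd (str_enc w) (str_enc y))) y \<le> 2 * length w + d"
    using Kc_upper[OF U, of fwd] Kc_upper[OF U, of bwd] by auto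
  define P where "P k a s \<longleftrightarrow> a < 2 ^ (100 * k) \<and>
    (\<forall>i<2 ^ k. \<exists>u<s. Lo (100 * k) a ((a + Q k + i) mod 2 ^ (100 * k)) u \<and>
      (\<exists>v<u. Hi (100 * k) a ((a + Q k + i) mod 2 ^ (100 * k)) v))" for k a s :: nat
  note HL = recpred_compose4[where P = Hi, OF Hi] recpred_compose4[where P = Lo, OF Lo]
  have "recpred 3 (\<lambda>xs. P (xs ! 0) (xs ! 1) (xs ! 2))"
    unfolding P_def by (intro recfn_intros HL Q') simp_all
  moreover have "\<exists>a s. P k a s" if k: "k \<ge> max k0 (c + d + 1)" for k
  proof -
    let ?n = "100 * k"
    let ?N = "2 ^ ?n :: nat"
    let ?G = "{a. a < ?N \<and> (\<forall>i<2 ^ k. \<exists>t. Hi ?n a ((a + Q k + i) mod ?N) t)}"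
    let ?B = "{a. a < ?N \<and> Kc U (word ?n a) [] < ?n - 1}"
    have "\<not> ?G \<subseteq> ?B"
    proof
      assume "?G \<subseteq> ?B"
      then have "card ?G \<le> card ?B" by (intro card_mono) auto
      also have "card ?B < 2 ^ (?n - 1)" by (rule card_word_Kc_less[OF U])
      finally have "card ?G < 2 ^ (?n - 1)" .
      moreover have "?N = 2 * 2 ^ (?n - 1)" using k by (simp flip: power_Suc)
      moreover have "3 * ?N \<le> 4 * card ?G" using Q_good k by simp
      ultimately show False by linarith
    qed
    then obtain a where "a \<in> ?G" "a \<notin> ?B" unfolding subset_iff not_all not_imp
      by (elim exE conjE)
    then have a: "a < ?N" "\<forall>i<2 ^ k. \<exists>t. Hi ?n a ((a + Q k + i) mod ?N) t"
      "?n - 1 \<le> K U (word ?n a)"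
      unfolding K_def by (auto simp: not_less)
    have "\<exists>u. Lo ?n a ((a + Q k + i) mod ?N) u \<and> (\<exists>v<u. Hi ?n a ((a + Q k + i) mod ?N) v)"
      if i: "i \<in> {..<2 ^ k}" for i
    proof -
      let ?x = "word ?n a" and ?y = "word ?n ((a + Q k + i) mod ?N)"
      have len: "length (str_dec (2 ^ k - 1 + i)) = k"
        using length_word[of i k] i unfolding word_def by simp
      have N: "Suc (2 ^ m - 1 + j) - 2 ^ m = j" for m j :: nat
      proof -
        have "(0::nat) < 2 ^ m" by simp
        then show ?thesis by linarith
      qed
      have "str_dec (fwd (str_enc (word k i)) (str_enc ?x)) = ?y"
        unfolding fwd_def str_enc_word Let_def len N unfolding word_def by (simp add: ac_simps)
      then have y: "Kc U ?y ?x \<le> 2 * k + c" using c[rule_format, of "word k i" ?x] i by simp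
      have "str_dec (bwd (str_enc (word k i)) (str_enc ?y)) = ?x"
        unfolding bwd_def str_enc_word Let_def len N unfolding word_def
        using shift_back[OF a(1), of "Q k + i"] by (simp only: add.assoc)
      then have "Kc U ?x ?y \<le> 2 * k + d" using d[rule_format, of "word k i" ?y] i by simp
      with y have "E U ?x ?y \<le> 2 * k + (c + d)" unfolding E_def by simp
      then have "10 * E U ?x ?y < K U ?x" using a(3) k by linarith
      then have "NID U ?x ?y < 1 / 10" by (intro NID_less_tenth) simp
      from NID_Lo[rule_format, OF this] obtain s where s: "\<forall>t\<ge>s. Lo ?n a ((a + Q k + i) mod ?N) t"
        unfolding eventually_sequentially by blast
      obtain v where v: "Hi ?n a ((a + Q k + i) mod ?N) v" using a(2) i by blast
      have "v < s + Suc v" "Lo ?n a ((a + Q k + i) mod ?N) (s + Suc v)" using s by simp_all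
      with v show ?thesis by blast
    qed
    then obtain s where "\<forall>i\<in>{..<2 ^ k}. \<exists>u<s. Lo ?n a ((a + Q k + i) mod ?N) u \<and>
        (\<exists>v<u. Hi ?n a ((a + Q k + i) mod ?N) v)"
      using bounded_witnesses[of "{..<2 ^ k}" "\<lambda>i u. Lo ?n a ((a + Q k + i) mod ?N) u \<and>
        (\<exists>v<u. Hi ?n a ((a + Q k + i) mod ?N) v)"] by auto
    with a(1) have "P k a s" unfolding P_def by simp
    then show ?thesis by blast
  qed
  ultimately obtain A where A: "recfn 1 (\<lambda>xs. A (xs ! 0))"
    "\<forall>k\<ge>max k0 (c + d + 1). \<exists>s. P k (A k) s"
    using recfn_search[of P "max k0 (c + d + 1)"] by auto
  have "A k < 2 ^ (100 * k) \<and>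
    (\<forall>i<2 ^ k. \<exists>u. Lo (100 * k) (A k) ((A k + Q k + i) mod 2 ^ (100 * k)) u \<and>
      (\<exists>v<u. Hi (100 * k) (A k) ((A k + Q k + i) mod 2 ^ (100 * k)) v))"
    if "k \<ge> max k0 (c + d + 1)" for k
  proof -
    from A(2)[rule_format, OF that] obtain s where "P k (A k) s" by (rule exE)
    then show ?thesis unfolding P_def by blast
  qed
  with A(1) show ?thesis by blast
qed

lemma partner_search:
  assumes U: "universal_pf_machine U"
    and Hi: "recpred 4 (\<lambda>xs. Hi (xs ! 0) (xs ! 1) (xs ! 2) (xs ! 3))"
    and Lo: "recpred 4 (\<lambda>xs. Lo (xs ! 0) (xs ! 1) (xs ! 2) (xs ! 3))"
    and NID_Hi: "\<forall>n a b. NID U (word n a) (word n b) > 1 / 3 \<longrightarrow>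
      (\<forall>\<^sub>F t in sequentially. Hi n a b t)"
    and Q: "recfn 1 (\<lambda>xs. Q (xs ! 0))" and A: "recfn 1 (\<lambda>xs. A (xs ! 0))"
    and A_good: "\<forall>k\<ge>k1. A k < 2 ^ (100 * k) \<and>
    (\<forall>i<2 ^ k. \<exists>u. Lo (100 * k) (A k) ((A k + Q k + i) mod 2 ^ (100 * k)) u \<and>
      (\<exists>v<u. Hi (100 * k) (A k) ((A k + Q k + i) mod 2 ^ (100 * k)) v))"
  shows "\<exists>I k2. recfn 1 (\<lambda>xs. I (xs ! 0)) \<and> (\<forall>k\<ge>k2.
    (\<exists>t. Hi (100 * k) (A k) ((A k + Q k + I k) mod 2 ^ (100 * k)) t \<and>
      (\<exists>u<t. Lo (100 * k) (A k) ((A k + Q k + I k) mod 2 ^ (100 * k)) u \<and>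
        (\<exists>v<u. Hi (100 * k) (A k) ((A k + Q k + I k) mod 2 ^ (100 * k)) v))))"
proof -
  note QA' = recfn_compose1[where f = Q, OF Q] recfn_compose1[where f = A, OF A]
  define f where "f w z = (let k = length (str_dec w); N = 2 ^ (100 * k) in
      N - 1 + (A k + Q k + (Suc w - 2 ^ k)) mod N)" for w z :: nat
  define g where "g w z = (let k = length (str_dec w) in 2 ^ (100 * k) - 1 + A k)" for w z :: nat
  have "recfn 2 (\<lambda>xs. f (xs ! 0) (xs ! 1))" "recfn 2 (\<lambda>xs. g (xs ! 0) (xs ! 1))"
    unfolding f_def g_def Let_def by (intro recfn_intros QA'; simp)+
  then obtain c d where
    c: "\<forall>w y. Kc U (str_dec (f (str_enc w) (str_enc y))) y \<le> 2 * length w + c" and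
    d: "\<forall>w y. Kc U (str_dec (g (str_enc w) (str_enc y))) y \<le> 2 * length w + d"
    using Kc_upper[OF U, of f] Kc_upper[OF U, of g] by auto
  define P where "P k i t \<longleftrightarrow> Hi (100 * k) (A k) ((A k + Q k + i) mod 2 ^ (100 * k)) t \<and>
      (\<exists>u<t. Lo (100 * k) (A k) ((A k + Q k + i) mod 2 ^ (100 * k)) u \<and>
        (\<exists>v<u. Hi (100 * k) (A k) ((A k + Q k + i) mod 2 ^ (100 * k)) v))" for k i t :: nat
  note HL = recpred_compose4[where P = Hi, OF Hi] recpred_compose4[where P = Lo, OF Lo]
  have "recpred 3 (\<lambda>xs. P (xs ! 0) (xs ! 1) (xs ! 2))"
    unfolding P_def by (intro recfn_intros HL QA') simp_all
  moreover have "\<exists>i t. P k i t" if k: "k \<ge> max k1 (c + d + 1)" for k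
  proof -
    let ?n = "100 * k"
    let ?N = "2 ^ ?n :: nat"
    let ?x = "word ?n (A k)" and ?y = "\<lambda>i. word ?n ((A k + Q k + i) mod ?N)"
    have kN: "(2::nat) ^ k \<le> ?N" by (intro power_increasing) auto
    have "\<exists>i<2 ^ k. k \<le> Kc U (?y i) ?x"
    proof (rule ccontr)
      assume neg: "\<not> ?thesis"
      have "inj_on ?y {..<2 ^ k}"
      proof (rule inj_onI)
        fix i j assume ij: "i \<in> {..<2 ^ k}" "j \<in> {..<2 ^ k}" "?y i = ?y j"
        then have "i < ?N" "j < ?N" using kN by (simp_all only: lessThan_iff order.strict_trans2)
        with ij(3) show "i = j" using add_mod_inj[of "A k + Q k" i ?N j] by simp
      qed
      then have "card {..<2 ^ k :: nat} \<le> card {z. Kc U z ?x < k}"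
        using neg by (intro card_inj_on_le) (auto simp: not_le card_Kc_less[OF U])
      with card_Kc_less(2)[OF U, of ?x k] show False by simp
    qed
    then obtain i where i: "i < 2 ^ k" "k \<le> Kc U (?y i) ?x" by blast
    have len: "length (str_dec (2 ^ k - 1 + i)) = k"
      using length_word[of i k] i unfolding word_def by simp
    have N: "Suc (2 ^ m - 1 + j) - 2 ^ m = j" for m j :: nat
    proof -
      have "(0::nat) < 2 ^ m" by simp
      then show ?thesis by linarith
    qed
    have "str_dec (f (str_enc (word k i)) (str_enc [])) = ?y i"
      unfolding f_def str_enc_word Let_def len N unfolding word_def ..
    then have y: "K U (?y i) \<le> 2 * k + c"
      using c[rule_format, of "word k i" "[]"] i unfolding K_def by simp
    have "str_dec (g (str_enc (word k i)) (str_enc [])) = ?x"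
      unfolding g_def str_enc_word Let_def len unfolding word_def ..
    then have x: "K U ?x \<le> 2 * k + d"
      using d[rule_format, of "word k i" "[]"] i unfolding K_def by simp
    have "k \<le> E U ?x (?y i)" using i unfolding E_def by simp
    with x y k have "K U ?x < 3 * E U ?x (?y i)" "K U (?y i) < 3 * E U ?x (?y i)" by linarith+
    then have "NID U ?x (?y i) > 1 / 3" by (rule NID_gt_third[OF U])
    from NID_Hi[rule_format, OF this] obtain s where
      s: "\<forall>t\<ge>s. Hi ?n (A k) ((A k + Q k + i) mod ?N) t"
      unfolding eventually_sequentially by blast
    have "\<exists>u. Lo ?n (A k) ((A k + Q k + i) mod ?N) u \<and>
      (\<exists>v<u. Hi ?n (A k) ((A k + Q k + i) mod ?N) v)"
      using A_good k i by simp
    then obtain u where u: "Lo ?n (A k) ((A k + Q k + i) mod ?N) u"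
      "\<exists>v<u. Hi ?n (A k) ((A k + Q k + i) mod ?N) v" by blast
    have "u < s + Suc u" "Hi ?n (A k) ((A k + Q k + i) mod ?N) (s + Suc u)" using s by simp_all
    with u have "P k i (s + Suc u)" unfolding P_def by blast
    then show ?thesis by blast
  qed
  ultimately obtain I where I: "recfn 1 (\<lambda>xs. I (xs ! 0))"
    "\<forall>k\<ge>max k1 (c + d + 1). \<exists>s. P k (I k) s"
    using recfn_search[of P "max k1 (c + d + 1)"] by auto
  then show ?thesis unfolding P_def
    by (intro exI[of _ I] exI[of _ "max k1 (c + d + 1)"] conjI)
qed

lemma Kc_given_length:
  assumes U: "universal_pf_machine U" and F: "recfn 1 (\<lambda>xs. F (xs ! 0))"
  shows "\<exists>c. \<forall>y. Kc U (str_dec (F (length y))) y \<le> c"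
proof -
  have "recfn 2 (\<lambda>xs. F (length (str_dec (xs ! 1))))"
    by (intro recfn_compose1[where f = F, OF F] recfn_intros) simp
  from Kc_upper[OF U, of "\<lambda>w y. F (length (str_dec y))", OF this]
  obtain c where "\<forall>w y. Kc U (str_dec (F (length (str_dec (str_enc y))))) y
      \<le> 2 * length (w :: bool list) + c"
    by (rule exE)
  from this[rule_format, of _ "[]"] show ?thesis by auto
qed

lemma NID_four_oscillations:
  assumes U: "universal_pf_machine U"
    and Hi: "recpred 4 (\<lambda>xs. Hi (xs ! 0) (xs ! 1) (xs ! 2) (xs ! 3))"
    and Lo: "recpred 4 (\<lambda>xs. Lo (xs ! 0) (xs ! 1) (xs ! 2) (xs ! 3))"
    and NID_Hi: "\<forall>n a b. NID U (word n a) (word n b) > 1 / 3 \<longrightarrow>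
      (\<forall>\<^sub>F t in sequentially. Hi n a b t)"
    and NID_Lo: "\<forall>n a b. NID U (word n a) (word n b) < 1 / 10 \<longrightarrow>
      (\<forall>\<^sub>F t in sequentially. Lo n a b t)"
  shows "\<exists>n a b t1 t2 t3 t4. t1 < t2 \<and> t2 < t3 \<and> t3 < t4 \<and>
    Hi n a b t1 \<and> Lo n a b t2 \<and> Hi n a b t3 \<and> Lo n a b t4"
proof -
  from shift_search[OF U Hi NID_Hi] obtain Q k0 where Q: "recfn 1 (\<lambda>xs. Q (xs ! 0))"
    "\<forall>k\<ge>k0. 3 * 2 ^ (100 * k) \<le> 4 * card {a. a < 2 ^ (100 * k) \<and>
      (\<forall>i<2 ^ k. \<exists>t. Hi (100 * k) a ((a + Q k + i) mod 2 ^ (100 * k)) t)}"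
    by (elim exE conjE)
  from base_point_search[OF U Hi Lo NID_Lo Q(1) Q(2)] obtain A k1 where
    A: "recfn 1 (\<lambda>xs. A (xs ! 0))"
    and A_good: "\<forall>k\<ge>k1. A k < 2 ^ (100 * k) \<and>
    (\<forall>i<2 ^ k. \<exists>u. Lo (100 * k) (A k) ((A k + Q k + i) mod 2 ^ (100 * k)) u \<and>
      (\<exists>v<u. Hi (100 * k) (A k) ((A k + Q k + i) mod 2 ^ (100 * k)) v))"
    by (elim exE conjE)
  from partner_search[OF U Hi Lo NID_Hi Q(1) A A_good] obtain I k2 where
    I: "recfn 1 (\<lambda>xs. I (xs ! 0))" and I_good: "\<forall>k\<ge>k2.
    (\<exists>t. Hi (100 * k) (A k) ((A k + Q k + I k) mod 2 ^ (100 * k)) t \<and>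
      (\<exists>u<t. Lo (100 * k) (A k) ((A k + Q k + I k) mod 2 ^ (100 * k)) u \<and>
        (\<exists>v<u. Hi (100 * k) (A k) ((A k + Q k + I k) mod 2 ^ (100 * k)) v)))"
    by (elim exE conjE)
  define x where "x k = word (100 * k) (A k)" for k
  define y where "y k = word (100 * k) ((A k + Q k + I k) mod 2 ^ (100 * k))" for k
  note QAI = recfn_compose1[where f = Q, OF Q(1)] recfn_compose1[where f = A, OF A]
    recfn_compose1[where f = I, OF I]
  have "recfn 1 (\<lambda>xs. 2 ^ (100 * (xs ! 0 div 100)) - 1 + A (xs ! 0 div 100))"
    by (intro recfn_intros QAI) simp_all
  from Kc_given_length[OF U, where F = "\<lambda>l. 2 ^ (100 * (l div 100)) - 1 + A (l div 100)", OF this]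
  obtain c where c: "\<forall>z. Kc U (x (length z div 100)) z \<le> c"
    unfolding x_def word_def by (rule exE)
  have "recfn 1 (\<lambda>xs. 2 ^ (100 * (xs ! 0 div 100)) - 1 +
      (A (xs ! 0 div 100) + Q (xs ! 0 div 100) + I (xs ! 0 div 100)) mod 2 ^ (100 * (xs ! 0 div 100)))"
    by (intro recfn_intros QAI) simp_all
  from Kc_given_length[OF U, where F = "\<lambda>l. 2 ^ (100 * (l div 100)) - 1 +
      (A (l div 100) + Q (l div 100) + I (l div 100)) mod 2 ^ (100 * (l div 100))", OF this]
  obtain d where d: "\<forall>z. Kc U (y (length z div 100)) z \<le> d"
    unfolding y_def word_def by (rule exE)
  have len: "length (x k) = 100 * k" if "k \<ge> k1" for k
    using A_good that unfolding x_def by simp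
  have "\<exists>k\<in>{max k1 k2..}. \<not> Kc U (x k) [] < Suc (10 * (c + d))"
  proof (rule ccontr)
    assume "\<not> ?thesis"
    then have "x ` {max k1 k2..} \<subseteq> {z. Kc U z [] < Suc (10 * (c + d))}" by blast
    then have "finite (x ` {max k1 k2..})"
      using card_Kc_less(1)[OF U] by (rule finite_subset)
    moreover have "inj_on x {max k1 k2..}"
    proof (rule inj_onI)
      fix i j assume ij: "i \<in> {max k1 k2..}" "j \<in> {max k1 k2..}" and eq: "x i = x j"
      have "100 * i = length (x i)" by (rule len[symmetric]) (use ij in simp)
      also have "\<dots> = 100 * j" unfolding eq by (rule len) (use ij in simp)
      finally show "i = j" by simp
    qed
    ultimately have "finite {max k1 k2..}" by (rule finite_imageD)
    then show False using infinite_Ici by blast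
  qed
  then obtain k where "k \<in> {max k1 k2..}" "\<not> Kc U (x k) [] < Suc (10 * (c + d))" by (rule bexE)
  then have k: "k \<ge> k1" "k \<ge> k2" "10 * (c + d) < K U (x k)" unfolding K_def by simp_all
  have "length (y k) = 100 * k" unfolding y_def by simp
  then have "E U (x k) (y k) \<le> c + d"
    using c[rule_format, of "y k"] d[rule_format, of "x k"] len[OF k(1)] unfolding E_def by simp
  with k(3) have "NID U (x k) (y k) < 1 / 10" by (intro NID_less_tenth) simp
  from NID_Lo[rule_format, OF this[unfolded x_def y_def]] obtain s where
    s: "\<forall>t\<ge>s. Lo (100 * k) (A k) ((A k + Q k + I k) mod 2 ^ (100 * k)) t"
    unfolding eventually_sequentially by blast
  let ?H = "Hi (100 * k) (A k) ((A k + Q k + I k) mod 2 ^ (100 * k))"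
  let ?L = "Lo (100 * k) (A k) ((A k + Q k + I k) mod 2 ^ (100 * k))"
  from I_good[rule_format, OF k(2)] obtain t u v where "v < u" "u < t" "?H v" "?L u" "?H t"
    by (elim exE conjE)
  moreover have "?L (s + Suc t)" "t < s + Suc t" using s by simp_all
  ultimately have "v < u \<and> u < t \<and> t < s + Suc t \<and> ?H v \<and> ?L u \<and> ?H t \<and> ?L (s + Suc t)"
    by (intro conjI)
  then show ?thesis by (intro exI)
qed

section \<open>Three phases are not enough\<close>

lemma phases_up_down_up:
  assumes "phases (alt_phases True 3) 0 g"
    and t: "t1 < t2" "t2 < t3" "t3 < t4"
    and g: "g t1 > \<alpha>" "g t2 < \<beta>" "g t3 > \<alpha>" "g t4 < \<beta>" and "\<beta> \<le> \<alpha>"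
  shows False
proof -
  have "alt_phases True 3 = [True, False, True]"
    by (simp add: alt_phases_def numeral_3_eq_3)
  with assms(1) obtain s1 s2 where
    s1: "\<forall>t t'. t \<le> t' \<and> t' < s1 \<longrightarrow> g t \<le> g t'" and
    s2: "\<forall>t t'. s1 \<le> t \<and> t \<le> t' \<and> t' < s2 \<longrightarrow> g t' \<le> g t" and
    s3: "\<forall>t t'. s2 \<le> t \<and> t \<le> t' \<longrightarrow> g t \<le> g t'"
    by (auto simp: dir_le_def)
  have "s1 \<le> t2" using s1[rule_format, of t1 t2] t g \<open>\<beta> \<le> \<alpha>\<close> by force
  then have "s2 \<le> t3" using s2[rule_format, of t2 t3] t g \<open>\<beta> \<le> \<alpha>\<close> by force
  then show False using s3[rule_format, of t3 t4] t g \<open>\<beta> \<le> \<alpha>\<close> by force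
qed

lemma rat_enc_compare:
  "q > 1 / 3 \<longleftrightarrow> fst (prod_decode (rat_enc q)) mod 2 = 0 \<and>
    snd (prod_decode (rat_enc q)) < 3 * (fst (prod_decode (rat_enc q)) div 2)"
  "q < 1 / 10 \<longleftrightarrow> fst (prod_decode (rat_enc q)) mod 2 = 1 \<or>
    10 * (fst (prod_decode (rat_enc q)) div 2) < snd (prod_decode (rat_enc q))"
proof -
  obtain a b where ab: "quotient_of q = (a, b)" by force
  then have b: "b > 0" and q: "q = of_int a / of_int b"
    using quotient_of_denom_pos quotient_of_div by blast+
  have enc: "fst (prod_decode (rat_enc q)) = int_encode a" "snd (prod_decode (rat_enc q)) = nat b"
    unfolding rat_enc_def ab by simp_all
  have hi: "q > 1 / 3 \<longleftrightarrow> b < 3 * a"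
  proof -
    have "q > 1 / 3 \<longleftrightarrow> (of_int b :: rat) < of_int (3 * a)"
      unfolding q using b by (simp add: field_simps)
    then show ?thesis unfolding of_int_less_iff .
  qed
  have lo: "q < 1 / 10 \<longleftrightarrow> 10 * a < b"
  proof -
    have "q < 1 / 10 \<longleftrightarrow> (of_int (10 * a) :: rat) < of_int b"
      unfolding q using b by (simp add: field_simps)
    then show ?thesis unfolding of_int_less_iff .
  qed
  show "q > 1 / 3 \<longleftrightarrow> fst (prod_decode (rat_enc q)) mod 2 = 0 \<and>
    snd (prod_decode (rat_enc q)) < 3 * (fst (prod_decode (rat_enc q)) div 2)"
    unfolding hi enc int_encode_def sum_encode_def using b by auto
  show "q < 1 / 10 \<longleftrightarrow> fst (prod_decode (rat_enc q)) mod 2 = 1 \<or>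
    10 * (fst (prod_decode (rat_enc q)) div 2) < snd (prod_decode (rat_enc q))"
    unfolding lo enc int_encode_def sum_encode_def using b by auto
qed

lemma recfn_rat_enc_approx:
  assumes "computable_approx f"
  shows "recfn 4 (\<lambda>xs. rat_enc (f (word (xs ! 0) (xs ! 1)) (word (xs ! 0) (xs ! 2)) (xs ! 3)))"
proof -
  obtain r where r: "\<forall>x y s. eval r [prod_encode (pair_enc x y, s)] (rat_enc (f x y s))"
    using assms unfolding computable_approx_def by (rule exE)
  define F where "F z = (let p = prod_decode z; q = prod_decode (fst p) in
    rat_enc (f (str_dec (fst q)) (str_dec (snd q)) (snd p)))" for z
  have "eval r [z] (F z)" for z
    using r[rule_format, of "str_dec (fst (prod_decode (fst (prod_decode z))))"
      "str_dec (snd (prod_decode (fst (prod_decode z))))" "snd (prod_decode z)"]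
    unfolding F_def pair_enc_def by (simp add: Let_def)
  then have "recfn 1 (\<lambda>xs. F (xs ! 0))"
    unfolding recfn_def by (intro exI[of _ r]) (auto simp: length_Suc_conv)
  note F = recfn_compose1[where f = F, OF this]
  have "recfn 4 (\<lambda>xs. F (prod_encode (prod_encode (2 ^ (xs ! 0) - 1 + xs ! 1,
      2 ^ (xs ! 0) - 1 + xs ! 2), xs ! 3)))"
    by (intro F recfn_intros) simp_all
  then show ?thesis unfolding F_def word_def by (simp add: Let_def)
qed

theorem mainTheorem11:
  assumes "universal_pf_machine U"
  shows "\<not> in_Sigma 3 (NID U)"
proof
  assume "in_Sigma 3 (NID U)"
  then obtain f where f: "computable_approx f"
    and lim: "\<And>x y. (\<lambda>s. real_of_rat (f x y s)) \<longlonglongrightarrow> NID U x y"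
    and ph: "\<And>x y. phases (alt_phases True 3) 0 (\<lambda>s. real_of_rat (f x y s))"
    unfolding in_Sigma_def by blast
  define Hi where "Hi n a b t \<longleftrightarrow> f (word n a) (word n b) t > 1 / 3" for n a b t
  define Lo where "Lo n a b t \<longleftrightarrow> f (word n a) (word n b) t < 1 / 10" for n a b t
  have Hi: "Hi n a b t \<longleftrightarrow> real_of_rat (f (word n a) (word n b) t) > 1 / 3" for n a b t
    unfolding Hi_def using of_rat_less[of "1 / 3" "f (word n a) (word n b) t", where 'a = real]
    by (simp add: of_rat_divide)
  have Lo: "Lo n a b t \<longleftrightarrow> real_of_rat (f (word n a) (word n b) t) < 1 / 10" for n a b t
    unfolding Lo_def using of_rat_less[of "f (word n a) (word n b) t" "1 / 10", where 'a = real]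
    by (simp add: of_rat_divide)
  have "\<exists>n a b t1 t2 t3 t4. t1 < t2 \<and> t2 < t3 \<and> t3 < t4 \<and>
    Hi n a b t1 \<and> Lo n a b t2 \<and> Hi n a b t3 \<and> Lo n a b t4"
  proof (rule NID_four_oscillations[OF assms])
    show "recpred 4 (\<lambda>xs. Hi (xs ! 0) (xs ! 1) (xs ! 2) (xs ! 3))"
      "recpred 4 (\<lambda>xs. Lo (xs ! 0) (xs ! 1) (xs ! 2) (xs ! 3))"
      unfolding Hi_def Lo_def rat_enc_compare
      by (intro recfn_intros recfn_rat_enc_approx[OF f])+
    show "\<forall>n a b. NID U (word n a) (word n b) > 1 / 3 \<longrightarrow> (\<forall>\<^sub>F t in sequentially. Hi n a b t)"
      unfolding Hi using order_tendstoD(1)[OF lim] by blast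
    show "\<forall>n a b. NID U (word n a) (word n b) < 1 / 10 \<longrightarrow> (\<forall>\<^sub>F t in sequentially. Lo n a b t)"
      unfolding Lo using order_tendstoD(2)[OF lim] by blast
  qed
  then obtain n a b t1 t2 t3 t4 where "t1 < t2" "t2 < t3" "t3 < t4"
    "Hi n a b t1" "Lo n a b t2" "Hi n a b t3" "Lo n a b t4"
    by (elim exE conjE)
  then show False
    unfolding Hi Lo by (rule phases_up_down_up[OF ph]) simp
qed

end
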